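(* Let $H$ be a (not necessarily finite) Heyting algebra, let $\mathcal{C}_H=\{x\in H : x\vee\neg x=\top\}$ denote the center of $H$, let $\mathbf{S}\subseteq H$ denote the set of non-central elements of $H$ (those $x$ with $x\vee\neg x\neq\top$), and take any maximal element $\sigma\in\mathbf{S}$ (i.e. for any $s'\in\mathbf{S}$, if $\sigma\le s'$ then $\sigma=s'$). The map $f:\mathcal{C}_H\to\mathbf{S}$ given by $$f(x)=\begin{cases}\sigma\wedge x & \text{if } \sigma\vee x=\top,\\ \sigma\wedge\neg x & \text{otherwise}\end{cases}$$ is well-defined and two-to-one.
   Context: A Heyting algebra is a bounded distributive lattice $\langle H,\wedge,\vee,\rightarrow,\bot,\top\rangle$ in which $a\rightarrow b$ is the maximum of $\{c : a\wedge c\le b\}$; $\neg x$ abbreviates $x\rightarrow\bot$. *)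

theory Defs
  imports Main "HOL-Library.FuncSet"
begin

unbundle lattice_syntax

(* The two axioms say that himp a b is the maximum of {c. a \<sqinter> c \<le> b}. *)
class heyting_algebra = distrib_lattice + bounded_lattice +
  fixes himp :: "'a \<Rightarrow> 'a \<Rightarrow> 'a"  (infixr \<open>\<rightarrow>\<^sub>H\<close> 60)
  assumes himp_mem: "a \<sqinter> (a \<rightarrow>\<^sub>H b) \<le> b"
    and himp_upper: "a \<sqinter> c \<le> b \<Longrightarrow> c \<le> a \<rightarrow>\<^sub>H b"

definition hneg :: "'a::heyting_algebra \<Rightarrow> 'a"  (\<open>\<not>\<^sub>H _\<close> [81] 80)
  where "\<not>\<^sub>H x = x \<rightarrow>\<^sub>H \<bottom>"

definition heyting_center :: "'a::heyting_algebra set"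
  where "heyting_center = {x. x \<squnion> \<not>\<^sub>H x = \<top>}"

definition noncentral :: "'a::heyting_algebra set"
  where "noncentral = {x. x \<squnion> \<not>\<^sub>H x \<noteq> \<top>}"

definition center_map :: "'a::heyting_algebra \<Rightarrow> 'a \<Rightarrow> 'a"
  where "center_map \<sigma> x = (if \<sigma> \<squnion> x = \<top> then \<sigma> \<sqinter> x else \<sigma> \<sqinter> \<not>\<^sub>H x)"

(* Fibres are required to have two elements only over the image: a two-to-one map need not be onto. *)
definition two_to_one_on :: "('a \<Rightarrow> 'b) \<Rightarrow> 'a set \<Rightarrow> bool"
  where "two_to_one_on f A \<longleftrightarrow> (\<forall>y \<in> f ` A. card {x \<in> A. f x = y} = 2)"

end

theory Submission
  imports Defs
begin

text \<open>
  The central elements are exactly the complemented ones, so they form a sublattice.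
  For central \<open>x\<close>, the meet of \<open>\<sigma> \<squnion> x\<close> and \<open>\<sigma> \<squnion> \<not>\<^sub>H x\<close> is the
  non-central \<open>\<sigma>\<close>, so one of the two joins is non-central and by maximality equals \<open>\<sigma>\<close>;
  the other is then \<open>\<top>\<close>. Hence exactly one element \<open>r\<close> of the pair \<open>x\<close>, \<open>\<not>\<^sub>H x\<close> satisfies
  \<open>\<sigma> \<squnion> r = \<top>\<close>, and \<open>f x = \<sigma> \<sqinter> r\<close>. In a distributive lattice \<open>r\<close> is determined by
  its join and meet with \<open>\<sigma>\<close>, so the fibre of \<open>f\<close> through \<open>x\<close> is \<open>{x, \<not>\<^sub>H x}\<close>.
\<close>

lemma distrib_lattice_cancel:
  fixes a b c :: "'a::distrib_lattice"
  assumes "c \<squnion> a = c \<squnion> b" and "c \<sqinter> a = c \<sqinter> b"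
  shows "a = b"
proof -
  have "a = a \<sqinter> (c \<squnion> b)"
    using assms(1) by (metis inf_sup_absorb sup_commute)
  also have "\<dots> = (c \<sqinter> b) \<squnion> (a \<sqinter> b)"
    using assms(2) by (simp add: inf_sup_distrib1 inf_commute)
  also have "\<dots> = b \<sqinter> (c \<squnion> a)"
    by (simp add: inf_sup_distrib1 inf_commute)
  also have "\<dots> = b"
    using assms(1) by (metis inf_sup_absorb sup_commute)
  finally show ?thesis .
qed

lemma inf_hneg [simp]: "x \<sqinter> \<not>\<^sub>H x = (\<bottom>::'a::heyting_algebra)"
  unfolding hneg_def using himp_mem[of x \<bottom>] by (simp add: bot_unique)

text \<open>Maximality of the implication gives only \<open>y \<le> \<not>\<^sub>H x\<close>. This
  already forces both elements to have the same join and meet with \<open>x\<close>, and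
  cancellation yields equality.\<close>

lemma hneg_unique:
  fixes x y :: "'a::heyting_algebra"
  assumes "x \<sqinter> y = \<bottom>" and "x \<squnion> y = \<top>"
  shows "\<not>\<^sub>H x = y"
proof (rule distrib_lattice_cancel)
  have "y \<le> \<not>\<^sub>H x"
    unfolding hneg_def using assms(1) by (intro himp_upper) simp
  then have "x \<squnion> y \<le> x \<squnion> \<not>\<^sub>H x"
    by (rule sup_mono[OF order_refl])
  then show "x \<squnion> \<not>\<^sub>H x = x \<squnion> y"
    using assms(2) by (simp add: top_unique)
  show "x \<sqinter> \<not>\<^sub>H x = x \<sqinter> y"
    using assms(1) by simp
qed

text \<open>Any complement must be the negation, so closure properties of the center reduce to
  exhibiting a complement.\<close>

lemma heyting_centerI:
  assumes "x \<sqinter> y = \<bottom>" and "x \<squnion> y = \<top>"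
  shows "x \<in> heyting_center"
  using hneg_unique[OF assms] assms(2) by (simp add: heyting_center_def)

lemma sup_hneg_center: "x \<in> heyting_center \<Longrightarrow> x \<squnion> \<not>\<^sub>H x = \<top>"
  by (simp add: heyting_center_def)

lemma hneg_hneg_center:
  assumes "x \<in> heyting_center"
  shows "\<not>\<^sub>H (\<not>\<^sub>H x) = x"
  using sup_hneg_center[OF assms] inf_hneg[of x]
  by (intro hneg_unique) (simp_all add: inf_commute sup_commute)

lemma hneg_center:
  assumes "x \<in> heyting_center"
  shows "\<not>\<^sub>H x \<in> heyting_center"
  using sup_hneg_center[OF assms] inf_hneg[of x]
  by (intro heyting_centerI[of _ x]) (simp_all add: inf_commute sup_commute)

lemma top_center: "\<top> \<in> heyting_center"
  by (rule heyting_centerI[of _ \<bottom>]) simp_all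

lemma inf_center:
  assumes "x \<in> heyting_center" and "y \<in> heyting_center"
  shows "x \<sqinter> y \<in> heyting_center"
proof (rule heyting_centerI)
  \<comment> \<open>The complement is the one suggested by De Morgan's law in a Boolean
    algebra.\<close>
  show "(x \<sqinter> y) \<sqinter> (\<not>\<^sub>H x \<squnion> \<not>\<^sub>H y) = \<bottom>"
    using inf_hneg[of x] inf_hneg[of y]
    by (metis inf_assoc inf_bot_right inf_commute inf_sup_distrib1 sup_bot.right_neutral)
  have "x \<squnion> (\<not>\<^sub>H x \<squnion> \<not>\<^sub>H y) = \<top>" "y \<squnion> (\<not>\<^sub>H x \<squnion> \<not>\<^sub>H y) = \<top>"
    using assms[THEN sup_hneg_center]
    by (metis sup_assoc sup_top_left, metis sup_left_commute sup_top_right)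
  then show "(x \<sqinter> y) \<squnion> (\<not>\<^sub>H x \<squnion> \<not>\<^sub>H y) = \<top>"
    by (simp add: sup_inf_distrib2)
qed

lemma sup_center:
  assumes "x \<in> heyting_center" and "y \<in> heyting_center"
  shows "x \<squnion> y \<in> heyting_center"
proof (rule heyting_centerI)
  have "x \<sqinter> (\<not>\<^sub>H x \<sqinter> \<not>\<^sub>H y) = \<bottom>" "y \<sqinter> (\<not>\<^sub>H x \<sqinter> \<not>\<^sub>H y) = \<bottom>"
    by (metis inf_assoc inf_bot_left inf_hneg, metis inf_left_commute inf_bot_right inf_hneg)
  then show "(x \<squnion> y) \<sqinter> (\<not>\<^sub>H x \<sqinter> \<not>\<^sub>H y) = \<bottom>"
    by (simp add: inf_sup_distrib2)
  have "x \<squnion> y \<squnion> \<not>\<^sub>H x = \<top>" "x \<squnion> y \<squnion> \<not>\<^sub>H y = \<top>"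
    using assms[THEN sup_hneg_center]
    by (metis sup_assoc sup_commute sup_top_right, metis sup_assoc sup_top_right)
  then show "(x \<squnion> y) \<squnion> (\<not>\<^sub>H x \<sqinter> \<not>\<^sub>H y) = \<top>"
    by (simp add: sup_inf_distrib1)
qed

lemma noncentral_iff: "x \<in> noncentral \<longleftrightarrow> x \<notin> heyting_center"
  by (simp add: noncentral_def heyting_center_def)

lemma sup_inf_sup_hneg: "(s \<squnion> x) \<sqinter> (s \<squnion> \<not>\<^sub>H x) = (s::'a::heyting_algebra)"
  by (simp flip: sup_inf_distrib1)

lemma sup_center_eq_top_iff:
  fixes \<sigma> x :: "'a::heyting_algebra"
  assumes \<sigma>: "\<sigma> \<in> noncentral"
    and max: "\<forall>s' \<in> noncentral. \<sigma> \<le> s' \<longrightarrow> \<sigma> = s'"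
    and x: "x \<in> heyting_center"
  shows "\<sigma> \<squnion> \<not>\<^sub>H x = \<top> \<longleftrightarrow> \<sigma> \<squnion> x \<noteq> \<top>"
proof
  assume "\<sigma> \<squnion> \<not>\<^sub>H x = \<top>"
  then show "\<sigma> \<squnion> x \<noteq> \<top>"
    \<comment> \<open>Were both joins \<open>\<top>\<close>, their meet \<open>\<sigma>\<close>
      would be \<open>\<top>\<close>, which is central.\<close>
    using sup_inf_sup_hneg[of \<sigma> x] \<sigma> top_center by (auto simp: noncentral_iff)
next
  assume neq: "\<sigma> \<squnion> x \<noteq> \<top>"
  have "\<sigma> \<squnion> x \<in> noncentral \<or> \<sigma> \<squnion> \<not>\<^sub>H x \<in> noncentral"
    using inf_center[of "\<sigma> \<squnion> x" "\<sigma> \<squnion> \<not>\<^sub>H x"] \<sigma>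
    by (auto simp: sup_inf_sup_hneg noncentral_iff)
  then have "\<sigma> = \<sigma> \<squnion> x \<or> \<sigma> = \<sigma> \<squnion> \<not>\<^sub>H x"
    using max by auto
  \<comment> \<open>Whichever of \<open>x\<close>, \<open>\<not>\<^sub>H x\<close> lies below
    \<open>\<sigma>\<close>, joining \<open>\<sigma>\<close> with the other gives
    \<open>\<top>\<close>; \<open>neq\<close> excludes that \<open>\<not>\<^sub>H x\<close> is the
    one below.\<close>
  then show "\<sigma> \<squnion> \<not>\<^sub>H x = \<top>"
    using neq sup_hneg_center[OF x] by (metis sup_assoc sup_commute sup_top_right)
qed

text \<open>If the meet were central, joining it with the central \<open>\<not>\<^sub>H r\<close>
  would make \<open>\<sigma> \<squnion> \<not>\<^sub>H r\<close> central. Since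
  \<open>\<sigma> \<squnion> r = \<top>\<close>, that join is \<open>\<sigma>\<close>
  itself.\<close>

lemma inf_noncentral:
  fixes \<sigma> r :: "'a::heyting_algebra"
  assumes \<sigma>: "\<sigma> \<in> noncentral"
    and r: "r \<in> heyting_center" and top: "\<sigma> \<squnion> r = \<top>"
  shows "\<sigma> \<sqinter> r \<in> noncentral"
proof (rule ccontr)
  assume "\<sigma> \<sqinter> r \<notin> noncentral"
  then have "(\<sigma> \<sqinter> r) \<squnion> \<not>\<^sub>H r \<in> heyting_center"
    using sup_center hneg_center[OF r] by (auto simp: noncentral_iff)
  moreover have "(\<sigma> \<sqinter> r) \<squnion> \<not>\<^sub>H r = \<sigma> \<squnion> \<not>\<^sub>H r"
    by (simp add: sup_inf_distrib2 sup_hneg_center[OF r])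
  ultimately have "(\<sigma> \<squnion> r) \<sqinter> (\<sigma> \<squnion> \<not>\<^sub>H r) \<in> heyting_center"
    using top by simp
  then show False
    using \<sigma> by (simp add: sup_inf_sup_hneg noncentral_iff)
qed

theorem theorem4p8:
  fixes \<sigma> :: "'a::heyting_algebra"
  assumes "\<sigma> \<in> noncentral"
    and "\<forall>s' \<in> noncentral. \<sigma> \<le> s' \<longrightarrow> \<sigma> = s'"
  shows "center_map \<sigma> \<in> heyting_center \<rightarrow> noncentral
    \<and> two_to_one_on (center_map \<sigma>) heyting_center"
proof
  note top_iff = sup_center_eq_top_iff[OF assms]
  define r where "r x = (if \<sigma> \<squnion> x = \<top> then x else \<not>\<^sub>H x)" for x
  have map_eq: "center_map \<sigma> x = \<sigma> \<sqinter> r x" for x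
    by (simp add: center_map_def r_def)
  have r_center: "r x \<in> heyting_center" if "x \<in> heyting_center" for x
    using that hneg_center[OF that] by (simp add: r_def)
  have r_top: "\<sigma> \<squnion> r x = \<top>" if "x \<in> heyting_center" for x
    using top_iff[OF that] by (simp add: r_def)
  show "center_map \<sigma> \<in> heyting_center \<rightarrow> noncentral"
    using inf_noncentral[OF assms(1) r_center r_top] by (auto simp: map_eq)
  have "card {y \<in> heyting_center. center_map \<sigma> y = center_map \<sigma> x} = 2"
    if x: "x \<in> heyting_center" for x
  proof -
    have "center_map \<sigma> y = center_map \<sigma> x \<longleftrightarrow> r y = r x" if "y \<in> heyting_center" for y
      using distrib_lattice_cancel[of \<sigma> "r y" "r x"] r_top[OF x] r_top[OF that]
      by (auto simp: map_eq)
    \<comment> \<open>Equal representatives give \<open>y = x\<close> or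
      \<open>y = \<not>\<^sub>H x\<close> after cancelling double negations. Conversely,
      \<open>x\<close> and \<open>\<not>\<^sub>H x\<close> share a representative because
      \<open>top_iff\<close> lets exactly one of them join with \<open>\<sigma>\<close> to
      \<open>\<top>\<close>.\<close>
    moreover have "r y = r x \<longleftrightarrow> y = x \<or> y = \<not>\<^sub>H x" if "y \<in> heyting_center" for y
      unfolding r_def using top_iff[OF x] hneg_hneg_center[OF x] hneg_hneg_center[OF that]
      by metis
    ultimately have "{y \<in> heyting_center. center_map \<sigma> y = center_map \<sigma> x} = {x, \<not>\<^sub>H x}"
      using x hneg_center[OF x] by auto
    \<comment> \<open>For \<open>x = \<not>\<^sub>H x\<close>, \<open>top_iff\<close> would equate a
      statement with its own negation.\<close>
    moreover have "x \<noteq> \<not>\<^sub>H x"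
      using top_iff[OF x] by metis
    ultimately show ?thesis by simp
  qed
  then show "two_to_one_on (center_map \<sigma>) heyting_center"
    by (auto simp: two_to_one_on_def)
qed

end
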